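(* For any two independent real-valued continuous random variables $X,Y$, $$h(X+Y)\leq 3h(X-Y)-h(X)-h(Y).$$ Equivalently, for any pair of real-valued continuous random variables $X,Y$, $d_R(X,-Y)\leq 3\,d_R(X,Y)$.
   Context: Standing conventions: random variables are real-valued with densities and all differential entropies $h$ appearing exist and are finite. The Ruzsa distance is $d_R(X,Y)=h(X'-Y')-\tfrac12h(X')-\tfrac12h(Y')$ with $X'\sim X$, $Y'\sim Y$ independent. *)

theory Defs
  imports "HOL-Probability.Probability"
begin

definition diff_entropy :: "'a measure \<Rightarrow> ('a \<Rightarrow> real) \<Rightarrow> real" where
  "diff_entropy M X = prob_space.entropy M (exp 1) lborel X"

text \<open>X has a density (is a continuous random variable) and its differential entropy
  exists and is finite.\<close>
definition has_finite_diff_entropy :: "'a measure \<Rightarrow> ('a \<Rightarrow> real) \<Rightarrow> bool" where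
  "has_finite_diff_entropy M X \<longleftrightarrow>
     (\<exists>f. information_space.finite_entropy M (exp 1) lborel X f)"

end

theory Submission
  imports Defs
begin

text \<open>Glue two copies $(X_1,Y_1)$, $(X_2,Y_2)$ of $(X,Y)$ conditionally independently along
  $X_1 - Y_1 = X_2 - Y_2$ and add an independent copy $(X_3,Y_3)$. Then
  $X_3 + Y_3 = (X_3 - Y_2) - (X_1 - Y_3) + X_2 + Y_1$, so $X_3 + Y_3$ is a function both of
  $U = (X_3 - Y_2, X_1 - Y_3, X_2, Y_1)$ and of $V = (X_3, Y_3)$, and submodularity
  $h(U,V) + h(X_3 + Y_3) \le h(U) + h(V)$ gives the claim. Since $(U,V)$ lives on a hyperplane,
  submodularity is replaced by Gibbs' inequality: with $f, g, k, s$ the densities of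
  $X$, $Y$, $X - Y$, $X + Y$, the ratio of the competing density
  $k(X_3 - Y_2) k(X_1 - Y_3) f(X_2) g(Y_1) f(X_3) g(Y_3) / s(X_3 + Y_3)$ to the joint density of
  the coupling has expectation at most 1, hence its logarithm has expectation at most 0.
  The factors in $X_2$ and $Y_1$ cancel, so only $X_3, Y_3, X_1 - Y_1, X_1, Y_2$ are kept.\<close>

section \<open>Substitutions for Lebesgue measure and laws tested against functions\<close>

lemma nn_integral_lborel_translate:
  fixes \<phi> :: "real \<Rightarrow> ennreal"
  assumes [measurable]: "\<phi> \<in> borel_measurable borel"
  shows "(\<integral>\<^sup>+x. \<phi> (x + c) \<partial>lborel) = (\<integral>\<^sup>+x. \<phi> x \<partial>lborel)"
  using nn_integral_real_affine[of \<phi> 1 c] by (simp add: add.commute)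

lemma nn_integral_lborel_reflect:
  fixes \<phi> :: "real \<Rightarrow> ennreal"
  assumes [measurable]: "\<phi> \<in> borel_measurable borel"
  shows "(\<integral>\<^sup>+x. \<phi> (c - x) \<partial>lborel) = (\<integral>\<^sup>+x. \<phi> x \<partial>lborel)"
  using nn_integral_real_affine[of \<phi> "-1" c] by simp

text \<open>Taking indicators as test functions recovers the law. Every law in this proof other than
  those of sums of independent variables is found by computing such integrals.\<close>

lemma distributed_lborelI:
  fixes T :: "'b \<Rightarrow> real" and p :: "real \<Rightarrow> ennreal"
  assumes T[measurable]: "T \<in> borel_measurable N" and p[measurable]: "p \<in> borel_measurable borel"
    and eq: "\<And>\<phi> :: real \<Rightarrow> ennreal. \<phi> \<in> borel_measurable borel \<Longrightarrow>
      (\<integral>\<^sup>+z. \<phi> (T z) \<partial>N) = (\<integral>\<^sup>+x. p x * \<phi> x \<partial>lborel)"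
  shows "distributed N lborel T p"
proof -
  have "distr N lborel T = density lborel p"
  proof (rule measure_eqI)
    fix A assume "A \<in> sets (distr N lborel T)"
    then have A[measurable]: "A \<in> sets borel" by simp
    have "emeasure (distr N lborel T) A = (\<integral>\<^sup>+x. indicator A x \<partial>distr N lborel T)"
      by simp
    also have "\<dots> = (\<integral>\<^sup>+z. indicator A (T z) \<partial>N)"
      by (rule nn_integral_distr) auto
    also have "\<dots> = (\<integral>\<^sup>+x. p x * indicator A x \<partial>lborel)"
      by (rule eq) simp
    also have "\<dots> = emeasure (density lborel p) A"
      by (simp add: emeasure_density)
    finally show "emeasure (distr N lborel T) A = emeasure (density lborel p) A" .
  qed simp
  then show ?thesis by (simp add: distributed_def)
qed

text \<open>The factors are arbitrary Euclidean spaces so that repeated rewriting unfolds the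
  integral over R^5 into five iterated ones.\<close>

lemma nn_integral_lborel_prod:
  fixes G :: "'b::euclidean_space \<times> 'c::euclidean_space \<Rightarrow> ennreal"
  assumes "G \<in> borel_measurable borel"
  shows "(\<integral>\<^sup>+z. G z \<partial>lborel) = (\<integral>\<^sup>+x. \<integral>\<^sup>+y. G (x, y) \<partial>lborel \<partial>lborel)"
  using assms lborel.nn_integral_fst[of G lborel] by (simp add: lborel_prod)

section \<open>Densities of X, Y, X - Y, X + Y and their convolution identities\<close>

text \<open>\<open>k\<close> and \<open>s\<close> are arbitrary versions of the densities of X - Y
  and X + Y, so they agree with the convolutions only almost everywhere.\<close>

locale convolved_densities =
  fixes f g k s :: "real \<Rightarrow> real"
  assumes meas[measurable]: "f \<in> borel_measurable borel" "g \<in> borel_measurable borel"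
      "k \<in> borel_measurable borel" "s \<in> borel_measurable borel"
    and nonneg: "\<And>x. 0 \<le> f x" "\<And>x. 0 \<le> g x" "\<And>x. 0 \<le> k x" "\<And>x. 0 \<le> s x"
    and total: "(\<integral>\<^sup>+x. ennreal (f x) \<partial>lborel) = 1" "(\<integral>\<^sup>+x. ennreal (g x) \<partial>lborel) = 1"
      "(\<integral>\<^sup>+x. ennreal (k x) \<partial>lborel) = 1"
    and conv_diff: "AE d in lborel. (\<integral>\<^sup>+y. ennreal (f (y + d)) * ennreal (g y) \<partial>lborel) = ennreal (k d)"
    and conv_sum: "AE t in lborel. (\<integral>\<^sup>+y. ennreal (f (t - y)) * ennreal (g y) \<partial>lborel) = ennreal (s t)"
begin

text \<open>The gluing below parametrizes one copy of (X, Y) by its first coordinate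
  \<open>x\<close> and the other by its second coordinate \<open>y\<close>; this is the form needed
  for the former.\<close>

lemma conv_diff': "AE d in lborel. (\<integral>\<^sup>+x. ennreal (f x) * ennreal (g (x - d)) \<partial>lborel) = ennreal (k d)"
  using conv_diff
proof eventually_elim
  case (elim d)
  then show ?case
    using nn_integral_lborel_translate[of "\<lambda>x. ennreal (f x) * ennreal (g (x - d))" d] by simp
qed

text \<open>The substitution \<open>x = y + d\<close> followed by Tonelli isolates the convolution
  in \<open>conv_diff\<close>.\<close>

lemma nn_integral_diff:
  fixes \<phi> :: "real \<Rightarrow> ennreal"
  assumes [measurable]: "\<phi> \<in> borel_measurable borel"
  shows "(\<integral>\<^sup>+y. ennreal (g y) * (\<integral>\<^sup>+x. ennreal (f x) * \<phi> (x - y) \<partial>lborel) \<partial>lborel)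
    = (\<integral>\<^sup>+d. ennreal (k d) * \<phi> d \<partial>lborel)"
proof -
  have "(\<integral>\<^sup>+y. ennreal (g y) * (\<integral>\<^sup>+x. ennreal (f x) * \<phi> (x - y) \<partial>lborel) \<partial>lborel)
    = (\<integral>\<^sup>+y. (\<integral>\<^sup>+d. ennreal (f (y + d)) * ennreal (g y) * \<phi> d \<partial>lborel) \<partial>lborel)"
  proof (rule nn_integral_cong)
    fix y
    have "(\<integral>\<^sup>+x. ennreal (f x) * \<phi> (x - y) \<partial>lborel) = (\<integral>\<^sup>+d. ennreal (f (y + d)) * \<phi> d \<partial>lborel)"
      using nn_integral_lborel_translate[of "\<lambda>x. ennreal (f x) * \<phi> (x - y)" y]
      by (simp add: add.commute)
    then show "ennreal (g y) * (\<integral>\<^sup>+x. ennreal (f x) * \<phi> (x - y) \<partial>lborel)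
      = (\<integral>\<^sup>+d. ennreal (f (y + d)) * ennreal (g y) * \<phi> d \<partial>lborel)"
      by (simp add: nn_integral_cmult[symmetric] ac_simps)
  qed
  also have "\<dots> = (\<integral>\<^sup>+d. (\<integral>\<^sup>+y. ennreal (f (y + d)) * ennreal (g y) * \<phi> d \<partial>lborel) \<partial>lborel)"
    by (rule lborel_pair.Fubini') simp
  also have "\<dots> = (\<integral>\<^sup>+d. (\<integral>\<^sup>+y. ennreal (f (y + d)) * ennreal (g y) \<partial>lborel) * \<phi> d \<partial>lborel)"
    by (simp add: nn_integral_multc)
  also have "\<dots> = (\<integral>\<^sup>+d. ennreal (k d) * \<phi> d \<partial>lborel)"
    using conv_diff by (intro nn_integral_cong_AE) auto
  finally show ?thesis .
qed

text \<open>Same argument with \<open>t = u + v\<close>, ending in \<open>conv_sum\<close>.\<close>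

lemma nn_integral_sum:
  fixes \<phi> :: "real \<Rightarrow> ennreal"
  assumes [measurable]: "\<phi> \<in> borel_measurable borel"
  shows "(\<integral>\<^sup>+u. \<integral>\<^sup>+v. ennreal (f u) * ennreal (g v) * \<phi> (u + v) \<partial>lborel \<partial>lborel)
    = (\<integral>\<^sup>+t. ennreal (s t) * \<phi> t \<partial>lborel)"
proof -
  have "(\<integral>\<^sup>+u. \<integral>\<^sup>+v. ennreal (f u) * ennreal (g v) * \<phi> (u + v) \<partial>lborel \<partial>lborel)
    = (\<integral>\<^sup>+v. \<integral>\<^sup>+u. ennreal (f u) * ennreal (g v) * \<phi> (u + v) \<partial>lborel \<partial>lborel)"
    by (rule lborel_pair.Fubini') simp
  also have "\<dots> = (\<integral>\<^sup>+v. \<integral>\<^sup>+t. ennreal (f (t - v)) * ennreal (g v) * \<phi> t \<partial>lborel \<partial>lborel)"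
  proof (rule nn_integral_cong)
    fix v
    show "(\<integral>\<^sup>+u. ennreal (f u) * ennreal (g v) * \<phi> (u + v) \<partial>lborel)
      = (\<integral>\<^sup>+t. ennreal (f (t - v)) * ennreal (g v) * \<phi> t \<partial>lborel)"
      using nn_integral_lborel_translate[of "\<lambda>t. ennreal (f (t - v)) * ennreal (g v) * \<phi> t" v]
      by simp
  qed
  also have "\<dots> = (\<integral>\<^sup>+t. \<integral>\<^sup>+v. ennreal (f (t - v)) * ennreal (g v) * \<phi> t \<partial>lborel \<partial>lborel)"
    by (rule lborel_pair.Fubini') simp
  also have "\<dots> = (\<integral>\<^sup>+t. (\<integral>\<^sup>+v. ennreal (f (t - v)) * ennreal (g v) \<partial>lborel) * \<phi> t \<partial>lborel)"
    by (simp add: nn_integral_multc)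
  also have "\<dots> = (\<integral>\<^sup>+t. ennreal (s t) * \<phi> t \<partial>lborel)"
    using conv_sum by (intro nn_integral_cong_AE) auto
  finally show ?thesis .
qed

section \<open>Gluing two copies of (X, Y) along their difference\<close>

text \<open>Integration against the law of $(X_1 - Y_1, X_1, Y_2)$, where $(X_1,Y_1)$ and $(X_2,Y_2)$ are
  copies of $(X,Y)$ that are conditionally independent given $X_1 - Y_1 = X_2 - Y_2$.\<close>

definition glued_integral :: "(real \<Rightarrow> real \<Rightarrow> real \<Rightarrow> ennreal) \<Rightarrow> ennreal" where
  "glued_integral \<phi> = (\<integral>\<^sup>+d. ennreal (1 / k d) * (\<integral>\<^sup>+x. ennreal (f x) * ennreal (g (x - d)) *
     (\<integral>\<^sup>+y. ennreal (f (y + d)) * ennreal (g y) * \<phi> d x y \<partial>lborel) \<partial>lborel) \<partial>lborel)"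

lemma reciprocal_mult_k: "k d \<noteq> 0 \<Longrightarrow> ennreal (1 / k d) * ennreal (k d) = 1"
  using nonneg(3)[of d] by (simp add: ennreal_mult[symmetric])

text \<open>For fixed \<open>d\<close> each copy integrates to \<open>k d\<close>, and the
  normalisation removes one of the two factors.\<close>

lemma glued_integral_diff:
  assumes [measurable]: "\<phi> \<in> borel_measurable borel"
  shows "glued_integral (\<lambda>d x y. \<phi> d) = (\<integral>\<^sup>+d. ennreal (k d) * \<phi> d \<partial>lborel)"
  unfolding glued_integral_def
proof (rule nn_integral_cong_AE)
  show "AE d in lborel. ennreal (1 / k d) * (\<integral>\<^sup>+x. ennreal (f x) * ennreal (g (x - d)) *
     (\<integral>\<^sup>+y. ennreal (f (y + d)) * ennreal (g y) * \<phi> d \<partial>lborel) \<partial>lborel) = ennreal (k d) * \<phi> d"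
    using conv_diff conv_diff'
  proof eventually_elim
    case (elim d)
    have "ennreal (1 / k d) * (ennreal (k d) * (ennreal (k d) * \<phi> d)) = ennreal (k d) * \<phi> d"
      using reciprocal_mult_k[of d] by (cases "k d = 0") (simp_all add: mult.assoc[symmetric])
    then show ?case
      by (simp add: nn_integral_multc elim)
  qed
qed

text \<open>Integrating out \<open>y\<close> produces a factor \<open>k d\<close> that cancels the
  normalisation. What remains is the joint law of X and X - Y for a single copy, and integrating out
  \<open>d\<close> uses that \<open>g\<close> has mass 1.\<close>

lemma glued_integral_fst:
  assumes [measurable]: "\<phi> \<in> borel_measurable borel"
  shows "glued_integral (\<lambda>d x y. \<phi> x) = (\<integral>\<^sup>+x. ennreal (f x) * \<phi> x \<partial>lborel)"
proof -
  have "glued_integral (\<lambda>d x y. \<phi> x)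
    = (\<integral>\<^sup>+d. (\<integral>\<^sup>+x. ennreal (f x) * \<phi> x * ennreal (g (x - d)) \<partial>lborel) \<partial>lborel)"
    unfolding glued_integral_def
  proof (rule nn_integral_cong_AE)
    show "AE d in lborel. ennreal (1 / k d) * (\<integral>\<^sup>+x. ennreal (f x) * ennreal (g (x - d)) *
      (\<integral>\<^sup>+y. ennreal (f (y + d)) * ennreal (g y) * \<phi> x \<partial>lborel) \<partial>lborel)
      = (\<integral>\<^sup>+x. ennreal (f x) * \<phi> x * ennreal (g (x - d)) \<partial>lborel)"
      using conv_diff conv_diff'
    proof eventually_elim
      case (elim d)
      have eq: "(\<integral>\<^sup>+x. ennreal (f x) * ennreal (g (x - d)) *
          (\<integral>\<^sup>+y. ennreal (f (y + d)) * ennreal (g y) * \<phi> x \<partial>lborel) \<partial>lborel)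
        = ennreal (k d) * (\<integral>\<^sup>+x. ennreal (f x) * \<phi> x * ennreal (g (x - d)) \<partial>lborel)"
        by (simp add: nn_integral_multc elim) (simp add: nn_integral_cmult[symmetric] ac_simps)
      show ?case
      proof (cases "k d = 0")
        \<comment> \<open>The left side is 0 because \<open>1 / 0 = 0\<close>; the right side is 0
          because a vanishing convolution has an almost everywhere vanishing integrand.\<close>
        case True
        then have "(\<integral>\<^sup>+x. ennreal (f x) * ennreal (g (x - d)) \<partial>lborel) = 0"
          using elim by simp
        then have "AE x in lborel. ennreal (f x) * ennreal (g (x - d)) = 0"
          by (subst (asm) nn_integral_0_iff_AE) auto
        then have "(\<integral>\<^sup>+x. ennreal (f x) * \<phi> x * ennreal (g (x - d)) \<partial>lborel) = 0"
          by (subst nn_integral_0_iff_AE) auto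
        then show ?thesis by (simp add: True)
      next
        case False
        then show ?thesis
          unfolding eq using reciprocal_mult_k[of d] by (simp add: mult.assoc[symmetric])
      qed
    qed
  qed
  also have "\<dots> = (\<integral>\<^sup>+x. (\<integral>\<^sup>+d. ennreal (f x) * \<phi> x * ennreal (g (x - d)) \<partial>lborel) \<partial>lborel)"
    by (rule lborel_pair.Fubini') simp
  also have "\<dots> = (\<integral>\<^sup>+x. ennreal (f x) * \<phi> x \<partial>lborel)"
    by (simp add: nn_integral_cmult nn_integral_lborel_reflect[of "\<lambda>x. ennreal (g x)"] total)
  finally show ?thesis .
qed

text \<open>Mirror image: \<open>x\<close> is integrated out by \<open>conv_diff'\<close>, and
  \<open>f\<close> having mass 1 removes \<open>d\<close>.\<close>

lemma glued_integral_snd: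
  assumes [measurable]: "\<phi> \<in> borel_measurable borel"
  shows "glued_integral (\<lambda>d x y. \<phi> y) = (\<integral>\<^sup>+y. ennreal (g y) * \<phi> y \<partial>lborel)"
proof -
  have "glued_integral (\<lambda>d x y. \<phi> y)
    = (\<integral>\<^sup>+d. (\<integral>\<^sup>+y. ennreal (g y) * \<phi> y * ennreal (f (y + d)) \<partial>lborel) \<partial>lborel)"
    unfolding glued_integral_def
  proof (rule nn_integral_cong_AE)
    show "AE d in lborel. ennreal (1 / k d) * (\<integral>\<^sup>+x. ennreal (f x) * ennreal (g (x - d)) *
      (\<integral>\<^sup>+y. ennreal (f (y + d)) * ennreal (g y) * \<phi> y \<partial>lborel) \<partial>lborel)
      = (\<integral>\<^sup>+y. ennreal (g y) * \<phi> y * ennreal (f (y + d)) \<partial>lborel)"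
      using conv_diff conv_diff'
    proof eventually_elim
      case (elim d)
      have eq: "(\<integral>\<^sup>+x. ennreal (f x) * ennreal (g (x - d)) *
          (\<integral>\<^sup>+y. ennreal (f (y + d)) * ennreal (g y) * \<phi> y \<partial>lborel) \<partial>lborel)
        = ennreal (k d) * (\<integral>\<^sup>+y. ennreal (g y) * \<phi> y * ennreal (f (y + d)) \<partial>lborel)"
        by (simp add: nn_integral_multc elim) (simp add: ac_simps)
      show ?case
      proof (cases "k d = 0")
        case True
        then have "(\<integral>\<^sup>+y. ennreal (f (y + d)) * ennreal (g y) \<partial>lborel) = 0"
          using elim by simp
        then have "AE y in lborel. ennreal (f (y + d)) * ennreal (g y) = 0"
          by (subst (asm) nn_integral_0_iff_AE) auto
        then have "(\<integral>\<^sup>+y. ennreal (g y) * \<phi> y * ennreal (f (y + d)) \<partial>lborel) = 0"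
          by (subst nn_integral_0_iff_AE) auto
        then show ?thesis by (simp add: True)
      next
        case False
        then show ?thesis
          unfolding eq using reciprocal_mult_k[of d] by (simp add: mult.assoc[symmetric])
      qed
    qed
  qed
  also have "\<dots> = (\<integral>\<^sup>+y. (\<integral>\<^sup>+d. ennreal (g y) * \<phi> y * ennreal (f (y + d)) \<partial>lborel) \<partial>lborel)"
    by (rule lborel_pair.Fubini') simp
  also have "\<dots> = (\<integral>\<^sup>+y. ennreal (g y) * \<phi> y \<partial>lborel)"
    using nn_integral_lborel_translate[of "\<lambda>x. ennreal (f x)"]
    by (simp add: nn_integral_cmult total add.commute)
  finally show ?thesis .
qed

section \<open>The five-variable coupling and its marginals\<close>

text \<open>The law of $(X_3, Y_3, X_1 - Y_1, X_1, Y_2)$, where $(X_3,Y_3)$ is an independent copy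
  of $(X,Y)$.\<close>

definition coupling :: "(real \<times> real \<times> real \<times> real \<times> real) measure" where
  "coupling = density lborel (\<lambda>(u, v, d, x, y). ennreal (f u) * ennreal (g v) * (ennreal (1 / k d) *
     (ennreal (f x) * ennreal (g (x - d)) * (ennreal (f (y + d)) * ennreal (g y)))))"

lemma sets_coupling[measurable_cong]: "sets coupling = sets borel"
  by (simp add: coupling_def)

text \<open>Tonelli separates the independent copy \<open>(u, v)\<close> from the glued pair, so the
  three glued marginals above become available.\<close>

lemma nn_integral_coupling:
  assumes F: "F \<in> borel_measurable borel"
  shows "(\<integral>\<^sup>+z. F z \<partial>coupling) = (\<integral>\<^sup>+u. \<integral>\<^sup>+v. ennreal (f u) * ennreal (g v) *
    glued_integral (\<lambda>d x y. F (u, v, d, x, y)) \<partial>lborel \<partial>lborel)"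
proof -
  define q where "q = (\<lambda>(u, v, d, x, y). ennreal (f u) * ennreal (g v) * (ennreal (1 / k d) *
     (ennreal (f x) * ennreal (g (x - d)) * (ennreal (f (y + d)) * ennreal (g y)))))"
  have F'[measurable]: "F \<in> borel_measurable (borel \<Otimes>\<^sub>M borel \<Otimes>\<^sub>M borel \<Otimes>\<^sub>M borel \<Otimes>\<^sub>M borel)"
    using F by (simp add: borel_prod)
  have q[measurable]: "q \<in> borel_measurable (borel \<Otimes>\<^sub>M borel \<Otimes>\<^sub>M borel \<Otimes>\<^sub>M borel \<Otimes>\<^sub>M borel)"
    unfolding q_def by measurable
  have "q \<in> borel_measurable borel"
    using q by (simp add: borel_prod)
  then have "(\<integral>\<^sup>+z. F z \<partial>coupling) = (\<integral>\<^sup>+z. q z * F z \<partial>lborel)"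
    unfolding coupling_def q_def[symmetric] using F by (simp add: nn_integral_density)
  also have "\<dots> = (\<integral>\<^sup>+u. \<integral>\<^sup>+v. \<integral>\<^sup>+d. \<integral>\<^sup>+x. \<integral>\<^sup>+y. q (u, v, d, x, y) * F (u, v, d, x, y)
       \<partial>lborel \<partial>lborel \<partial>lborel \<partial>lborel \<partial>lborel)"
    by (simp add: nn_integral_lborel_prod borel_prod[symmetric])
  also have "\<dots> = (\<integral>\<^sup>+u. \<integral>\<^sup>+v. ennreal (f u) * ennreal (g v) *
    glued_integral (\<lambda>d x y. F (u, v, d, x, y)) \<partial>lborel \<partial>lborel)"
    unfolding glued_integral_def q_def
    by (simp add: nn_integral_cmult[symmetric] mult.assoc)
  finally show ?thesis .
qed

lemma distributed_couplingI:
  assumes T: "T \<in> borel_measurable borel" and p: "p \<in> borel_measurable borel"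
    and eq: "\<And>\<phi> :: real \<Rightarrow> ennreal. \<phi> \<in> borel_measurable borel \<Longrightarrow>
      (\<integral>\<^sup>+u. \<integral>\<^sup>+v. ennreal (f u) * ennreal (g v) *
        glued_integral (\<lambda>d x y. \<phi> (T (u, v, d, x, y))) \<partial>lborel \<partial>lborel)
      = (\<integral>\<^sup>+t. p t * \<phi> t \<partial>lborel)"
  shows "distributed coupling lborel T p"
proof (rule distributed_lborelI)
  show "T \<in> borel_measurable coupling"
    using T by (simp cong: measurable_cong_sets add: sets_coupling)
next
  fix \<phi> :: "real \<Rightarrow> ennreal" assume \<phi>: "\<phi> \<in> borel_measurable borel"
  show "(\<integral>\<^sup>+z. \<phi> (T z) \<partial>coupling) = (\<integral>\<^sup>+t. p t * \<phi> t \<partial>lborel)"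
    using nn_integral_coupling[OF measurable_compose[OF T \<phi>]] eq[OF \<phi>] by simp
qed fact

lemma nn_integral_fg_const: "(\<integral>\<^sup>+u. \<integral>\<^sup>+v. ennreal (f u) * ennreal (g v) * C \<partial>lborel \<partial>lborel) = C"
  by (simp add: nn_integral_multc nn_integral_cmult total)

lemma glued_integral_const: "glued_integral (\<lambda>d x y. C) = C"
  using glued_integral_fst[of "\<lambda>_. C"] by (simp add: nn_integral_multc total)

lemma prob_space_coupling: "prob_space coupling"
proof
  have "emeasure coupling (space coupling) = (\<integral>\<^sup>+z. 1 \<partial>coupling)"
    by simp
  also have "\<dots> = 1"
    by (subst nn_integral_coupling) (simp_all add: glued_integral_const nn_integral_fg_const[of 1, simplified])
  finally show "emeasure coupling (space coupling) = 1" .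
qed

text \<open>These are exactly the arguments occurring in the likelihood ratio. The laws of
  \<open>u - y\<close> and \<open>x - v\<close> come from independence: \<open>u\<close> is
  independent of the glued variable \<open>y\<close>, which has density \<open>g\<close>, and
  \<open>v\<close> of the glued variable \<open>x\<close>, which has density
  \<open>f\<close>.\<close>

lemma distributed_coupling:
  "distributed coupling lborel (\<lambda>(u, v, d, x, y). x) (\<lambda>t. ennreal (f t))"
  "distributed coupling lborel (\<lambda>(u, v, d, x, y). y) (\<lambda>t. ennreal (g t))"
  "distributed coupling lborel (\<lambda>(u, v, d, x, y). d) (\<lambda>t. ennreal (k t))"
  "distributed coupling lborel (\<lambda>(u, v, d, x, y). u - y) (\<lambda>t. ennreal (k t))"
  "distributed coupling lborel (\<lambda>(u, v, d, x, y). x - v) (\<lambda>t. ennreal (k t))"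
  "distributed coupling lborel (\<lambda>(u, v, d, x, y). u + v) (\<lambda>t. ennreal (s t))"
proof -
  show "distributed coupling lborel (\<lambda>(u, v, d, x, y). x) (\<lambda>t. ennreal (f t))"
    by (rule distributed_couplingI)
       (simp_all add: borel_prod[symmetric] glued_integral_fst nn_integral_fg_const)
  show "distributed coupling lborel (\<lambda>(u, v, d, x, y). y) (\<lambda>t. ennreal (g t))"
    by (rule distributed_couplingI)
       (simp_all add: borel_prod[symmetric] glued_integral_snd nn_integral_fg_const)
  show "distributed coupling lborel (\<lambda>(u, v, d, x, y). d) (\<lambda>t. ennreal (k t))"
    by (rule distributed_couplingI)
       (simp_all add: borel_prod[symmetric] glued_integral_diff nn_integral_fg_const)
  show "distributed coupling lborel (\<lambda>(u, v, d, x, y). u + v) (\<lambda>t. ennreal (s t))"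
    by (rule distributed_couplingI)
       (simp_all add: borel_prod[symmetric] glued_integral_const nn_integral_sum)
  show "distributed coupling lborel (\<lambda>(u, v, d, x, y). x - v) (\<lambda>t. ennreal (k t))"
  proof (rule distributed_couplingI, unfold prod.case)
    fix \<phi> :: "real \<Rightarrow> ennreal" assume [measurable]: "\<phi> \<in> borel_measurable borel"
    show "(\<integral>\<^sup>+u. \<integral>\<^sup>+v. ennreal (f u) * ennreal (g v) * glued_integral (\<lambda>d x y. \<phi> (x - v)) \<partial>lborel \<partial>lborel)
        = (\<integral>\<^sup>+t. ennreal (k t) * \<phi> t \<partial>lborel)"
      by (simp add: glued_integral_fst[of "\<lambda>x. \<phi> (x - _)"] mult.assoc nn_integral_cmult
        nn_integral_multc total nn_integral_diff)
  qed (simp_all add: borel_prod[symmetric])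
  show "distributed coupling lborel (\<lambda>(u, v, d, x, y). u - y) (\<lambda>t. ennreal (k t))"
  proof (rule distributed_couplingI, unfold prod.case)
    fix \<phi> :: "real \<Rightarrow> ennreal" assume [measurable]: "\<phi> \<in> borel_measurable borel"
    have "(\<integral>\<^sup>+u. \<integral>\<^sup>+v. ennreal (f u) * ennreal (g v) * glued_integral (\<lambda>d x y. \<phi> (u - y)) \<partial>lborel \<partial>lborel)
      = (\<integral>\<^sup>+u. \<integral>\<^sup>+y. ennreal (g y) * (ennreal (f u) * \<phi> (u - y)) \<partial>lborel \<partial>lborel)"
      by (simp add: glued_integral_snd[of "\<lambda>y. \<phi> (_ - y)"] nn_integral_cmult
        nn_integral_multc total) (simp add: nn_integral_cmult[symmetric] ac_simps)
    \<comment> \<open>\<open>nn_integral_diff\<close> has the variable of \<open>g\<close>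
      outermost.\<close>
    also have "\<dots> = (\<integral>\<^sup>+y. \<integral>\<^sup>+u. ennreal (g y) * (ennreal (f u) * \<phi> (u - y)) \<partial>lborel \<partial>lborel)"
      by (rule lborel_pair.Fubini') simp
    also have "\<dots> = (\<integral>\<^sup>+t. ennreal (k t) * \<phi> t \<partial>lborel)"
      by (simp add: nn_integral_cmult nn_integral_diff)
    finally show "(\<integral>\<^sup>+u. \<integral>\<^sup>+v. ennreal (f u) * ennreal (g v) * glued_integral (\<lambda>d x y. \<phi> (u - y)) \<partial>lborel \<partial>lborel)
        = (\<integral>\<^sup>+t. ennreal (k t) * \<phi> t \<partial>lborel)" .
  qed (simp_all add: borel_prod[symmetric])
qed

section \<open>The likelihood ratio has expectation at most 1\<close>

text \<open>The competing density over the density of \<open>coupling\<close>, with X_2 =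
  \<open>y + d\<close> and Y_1 = \<open>x - d\<close>, after cancelling \<open>f u\<close>,
  \<open>g v\<close>, \<open>f (y + d)\<close> and \<open>g (x - d)\<close>.\<close>

definition likelihood_ratio :: "real \<times> real \<times> real \<times> real \<times> real \<Rightarrow> real" where
  "likelihood_ratio = (\<lambda>(u, v, d, x, y). k d * k (u - y) * k (x - v) / (f x * g y * s (u + v)))"

text \<open>The density of $A - B + X + Y$ for independent $X$, $Y$, $A$, $B$ with
  $A$ and $B$ distributed like $X - Y$.\<close>

definition mixed_density :: "real \<Rightarrow> ennreal" where
  "mixed_density t = (\<integral>\<^sup>+e. (\<integral>\<^sup>+b. ennreal (g (b - e)) * ennreal (k b) \<partial>lborel) *
     (\<integral>\<^sup>+a. ennreal (f (t - a + e)) * ennreal (k a) \<partial>lborel) \<partial>lborel)"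

lemma mixed_density_measurable[measurable]: "mixed_density \<in> borel_measurable borel"
  unfolding mixed_density_def[abs_def] by measurable

text \<open>Tonelli with \<open>t\<close> innermost: for each \<open>e\<close> the factor depending
  on \<open>t\<close> has mass 1, and the other factor then has mass 1 by integrating
  \<open>e\<close> before \<open>b\<close>.\<close>

lemma nn_integral_mixed_density: "(\<integral>\<^sup>+t. mixed_density t \<partial>lborel) = 1"
proof -
  have inner: "(\<integral>\<^sup>+t. \<integral>\<^sup>+a. ennreal (f (t - a + e)) * ennreal (k a) \<partial>lborel \<partial>lborel) = 1" for e
  proof -
    have "(\<integral>\<^sup>+t. \<integral>\<^sup>+a. ennreal (f (t - a + e)) * ennreal (k a) \<partial>lborel \<partial>lborel)
      = (\<integral>\<^sup>+a. \<integral>\<^sup>+t. ennreal (f (t - a + e)) * ennreal (k a) \<partial>lborel \<partial>lborel)"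
      by (rule lborel_pair.Fubini') simp
    also have "\<dots> = (\<integral>\<^sup>+a. (\<integral>\<^sup>+t. ennreal (f (t + (e - a))) \<partial>lborel) * ennreal (k a) \<partial>lborel)"
      by (simp add: nn_integral_multc) (simp add: algebra_simps)
    also have "\<dots> = 1"
      using nn_integral_lborel_translate[of "\<lambda>t. ennreal (f t)"] by (simp add: total)
    finally show ?thesis .
  qed
  have "(\<integral>\<^sup>+t. mixed_density t \<partial>lborel) =
    (\<integral>\<^sup>+e. \<integral>\<^sup>+t. (\<integral>\<^sup>+b. ennreal (g (b - e)) * ennreal (k b) \<partial>lborel) *
     (\<integral>\<^sup>+a. ennreal (f (t - a + e)) * ennreal (k a) \<partial>lborel) \<partial>lborel \<partial>lborel)"
    unfolding mixed_density_def by (rule lborel_pair.Fubini') simp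
  also have "\<dots> = (\<integral>\<^sup>+e. \<integral>\<^sup>+b. ennreal (g (b - e)) * ennreal (k b) \<partial>lborel \<partial>lborel)"
    by (simp add: nn_integral_cmult inner)
  also have "\<dots> = (\<integral>\<^sup>+b. \<integral>\<^sup>+e. ennreal (g (b - e)) * ennreal (k b) \<partial>lborel \<partial>lborel)"
    by (rule lborel_pair.Fubini') simp
  also have "\<dots> = 1"
    by (simp add: nn_integral_multc nn_integral_lborel_reflect[of "\<lambda>x. ennreal (g x)"] total)
  finally show ?thesis .
qed

text \<open>Against the gluing density the factors \<open>k d\<close>, \<open>f x\<close> and
  \<open>g y\<close> cancel. The remaining integrand is a product of a function of \<open>x\<close>
  and a function of \<open>y\<close> for each \<open>d\<close>, hence a convolution that depends on
  \<open>u\<close> and \<open>v\<close> only through \<open>u + v\<close>.\<close>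

lemma glued_integral_likelihood_ratio_le:
  "glued_integral (\<lambda>d x y. ennreal (likelihood_ratio (u, v, d, x, y)))
    \<le> ennreal (1 / s (u + v)) * mixed_density (u + v)"
proof -
  have pointwise: "ennreal (1 / k d) * (ennreal (f x) * ennreal (g (x - d)) *
      (ennreal (f (y + d)) * ennreal (g y) * ennreal (likelihood_ratio (u, v, d, x, y))))
    \<le> ennreal (1 / s (u + v)) * ((ennreal (g (x - d)) * ennreal (k (x - v))) *
        (ennreal (f (y + d)) * ennreal (k (u - y))))" for d x y
  proof -
    have "1 / k d * (f x * g (x - d) * (f (y + d) * g y * likelihood_ratio (u, v, d, x, y)))
      = (k d / k d) * (f x / f x) * (g y / g y) *
        (1 / s (u + v) * ((g (x - d) * k (x - v)) * (f (y + d) * k (u - y))))"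
      by (simp add: likelihood_ratio_def)
    \<comment> \<open>Each quotient such as \<open>k d / k d\<close> is 1, or 0 where the density
      vanishes; hence an inequality rather than an equality.\<close>
    also have "\<dots> \<le> 1 * (1 / s (u + v) * ((g (x - d) * k (x - v)) * (f (y + d) * k (u - y))))"
      using nonneg by (intro mult_right_mono) (auto simp: divide_self_if)
    finally have "1 / k d * (f x * g (x - d) * (f (y + d) * g y * likelihood_ratio (u, v, d, x, y)))
      \<le> 1 / s (u + v) * ((g (x - d) * k (x - v)) * (f (y + d) * k (u - y)))"
      by simp
    moreover have "0 \<le> likelihood_ratio (u, v, d, x, y)"
      using nonneg by (simp add: likelihood_ratio_def)
    ultimately show ?thesis
      using nonneg by (simp add: ennreal_mult[symmetric] del: times_divide_eq_left times_divide_eq_right)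
  qed
  have [measurable]: "(\<lambda>(d, x, y). likelihood_ratio (u, v, d, x, y)) \<in> borel_measurable (borel \<Otimes>\<^sub>M borel \<Otimes>\<^sub>M borel)"
    unfolding likelihood_ratio_def prod.case by measurable
  have "glued_integral (\<lambda>d x y. ennreal (likelihood_ratio (u, v, d, x, y))) =
    (\<integral>\<^sup>+d. \<integral>\<^sup>+x. \<integral>\<^sup>+y. ennreal (1 / k d) * (ennreal (f x) * ennreal (g (x - d)) *
      (ennreal (f (y + d)) * ennreal (g y) * ennreal (likelihood_ratio (u, v, d, x, y))))
       \<partial>lborel \<partial>lborel \<partial>lborel)"
    unfolding glued_integral_def by (simp add: nn_integral_cmult)
  also have "\<dots> \<le> (\<integral>\<^sup>+d. \<integral>\<^sup>+x. \<integral>\<^sup>+y. ennreal (1 / s (u + v)) *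
      ((ennreal (g (x - d)) * ennreal (k (x - v))) * (ennreal (f (y + d)) * ennreal (k (u - y))))
       \<partial>lborel \<partial>lborel \<partial>lborel)"
    by (intro nn_integral_mono pointwise)
  also have "\<dots> = ennreal (1 / s (u + v)) *
     (\<integral>\<^sup>+d. (\<integral>\<^sup>+x. ennreal (g (x - d)) * ennreal (k (x - v)) \<partial>lborel) *
        (\<integral>\<^sup>+y. ennreal (f (y + d)) * ennreal (k (u - y)) \<partial>lborel) \<partial>lborel)"
    by (simp add: nn_integral_cmult nn_integral_multc)
  also have "(\<integral>\<^sup>+d. (\<integral>\<^sup>+x. ennreal (g (x - d)) * ennreal (k (x - v)) \<partial>lborel) *
        (\<integral>\<^sup>+y. ennreal (f (y + d)) * ennreal (k (u - y)) \<partial>lborel) \<partial>lborel)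
    = (\<integral>\<^sup>+d. (\<integral>\<^sup>+b. ennreal (g (b + v - d)) * ennreal (k b) \<partial>lborel) *
        (\<integral>\<^sup>+a. ennreal (f (u - a + d)) * ennreal (k a) \<partial>lborel) \<partial>lborel)"
  proof (rule nn_integral_cong)
    fix d
    have "(\<integral>\<^sup>+x. ennreal (g (x - d)) * ennreal (k (x - v)) \<partial>lborel)
      = (\<integral>\<^sup>+b. ennreal (g (b + v - d)) * ennreal (k b) \<partial>lborel)"
      using nn_integral_lborel_translate[of "\<lambda>x. ennreal (g (x - d)) * ennreal (k (x - v))" v] by simp
    moreover have "(\<integral>\<^sup>+y. ennreal (f (y + d)) * ennreal (k (u - y)) \<partial>lborel)
      = (\<integral>\<^sup>+a. ennreal (f (u - a + d)) * ennreal (k a) \<partial>lborel)"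
      using nn_integral_lborel_reflect[of "\<lambda>a. ennreal (f (u - a + d)) * ennreal (k a)" u] by simp
    ultimately show "(\<integral>\<^sup>+x. ennreal (g (x - d)) * ennreal (k (x - v)) \<partial>lborel) *
        (\<integral>\<^sup>+y. ennreal (f (y + d)) * ennreal (k (u - y)) \<partial>lborel)
      = (\<integral>\<^sup>+b. ennreal (g (b + v - d)) * ennreal (k b) \<partial>lborel) *
        (\<integral>\<^sup>+a. ennreal (f (u - a + d)) * ennreal (k a) \<partial>lborel)"
      by simp
  qed
  \<comment> \<open>The shift \<open>d = e + v\<close> gives the arguments \<open>b - e\<close> and
    \<open>(u + v) - a + e\<close>.\<close>
  also have "\<dots> = mixed_density (u + v)"
    unfolding mixed_density_def
    by (subst nn_integral_lborel_translate[symmetric, where c = v]) (simp_all add: algebra_simps)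
  finally show ?thesis .
qed

lemma likelihood_ratio_measurable[measurable]:
  "likelihood_ratio \<in> borel_measurable borel"
  unfolding likelihood_ratio_def borel_prod[symmetric] by measurable

text \<open>The previous bound is a function of \<open>u + v\<close>, so averaging over
  \<open>(u, v)\<close> brings in the weight \<open>s\<close>. This cancels \<open>1 / s\<close>
  where \<open>s\<close> is positive, leaving at most the mass of
  \<open>mixed_density\<close>.\<close>

lemma nn_integral_likelihood_ratio_le:
  "(\<integral>\<^sup>+z. ennreal (likelihood_ratio z) \<partial>coupling) \<le> 1"
proof -
  have "(\<integral>\<^sup>+z. ennreal (likelihood_ratio z) \<partial>coupling)
    \<le> (\<integral>\<^sup>+u. \<integral>\<^sup>+v. ennreal (f u) * ennreal (g v) *
        (ennreal (1 / s (u + v)) * mixed_density (u + v)) \<partial>lborel \<partial>lborel)"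
    unfolding nn_integral_coupling[OF measurable_compose[OF likelihood_ratio_measurable measurable_ennreal]]
    by (intro nn_integral_mono mult_left_mono glued_integral_likelihood_ratio_le) simp
  also have "\<dots> = (\<integral>\<^sup>+t. ennreal (s t) * (ennreal (1 / s t) * mixed_density t) \<partial>lborel)"
    by (rule nn_integral_sum) measurable
  also have "\<dots> \<le> (\<integral>\<^sup>+t. mixed_density t \<partial>lborel)"
  proof (rule nn_integral_mono)
    fix t
    have "ennreal (s t) * ennreal (1 / s t) \<le> 1"
      using nonneg(4)[of t] by (cases "s t = 0") (simp_all add: ennreal_mult[symmetric])
    then show "ennreal (s t) * (ennreal (1 / s t) * mixed_density t) \<le> mixed_density t"
      using mult_right_mono[of "ennreal (s t) * ennreal (1 / s t)" 1 "mixed_density t"]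
      by (simp add: mult.assoc)
  qed
  also have "\<dots> = 1" by (rule nn_integral_mixed_density)
  finally show ?thesis .
qed

section \<open>Gibbs' inequality for the coupling\<close>

text \<open>Since \<open>ln r \<le> r - 1\<close>, the log-likelihood ratio has expectation at most
  0. By linearity this expectation splits into the six marginal entropy integrals, three of them for
  \<open>k\<close>.\<close>

lemma entropy_sum_le:
  assumes int: "integrable lborel (\<lambda>x. f x * ln (f x))" "integrable lborel (\<lambda>x. g x * ln (g x))"
    "integrable lborel (\<lambda>x. k x * ln (k x))" "integrable lborel (\<lambda>x. s x * ln (s x))"
  shows "- (\<integral>x. s x * ln (s x) \<partial>lborel) \<le> - 3 * (\<integral>x. k x * ln (k x) \<partial>lborel)
    + (\<integral>x. f x * ln (f x) \<partial>lborel) + (\<integral>x. g x * ln (g x) \<partial>lborel)"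
proof -
  interpret prob_space coupling by (rule prob_space_coupling)
  \<comment> \<open>The expected log-density is minus the entropy. A density is almost surely
    positive at its own variable, which later allows the logarithm of the ratio to be split.\<close>
  have ln_law: "integrable coupling (\<lambda>z. ln (p (T z)))"
      "(\<integral>z. ln (p (T z)) \<partial>coupling) = (\<integral>x. p x * ln (p x) \<partial>lborel)"
      "AE z in coupling. 0 < p (T z)"
    if D: "distributed coupling lborel T (\<lambda>x. ennreal (p x))"
      and p[measurable]: "p \<in> borel_measurable borel" and nn: "\<And>x. 0 \<le> p x"
      and I: "integrable lborel (\<lambda>x. p x * ln (p x))" for T p
  proof -
    show "integrable coupling (\<lambda>z. ln (p (T z)))"
      using distributed_integrable[OF D, of "\<lambda>x. ln (p x)"] nn I by simp
    show "(\<integral>z. ln (p (T z)) \<partial>coupling) = (\<integral>x. p x * ln (p x) \<partial>lborel)"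
      using distributed_integral[OF D, of "\<lambda>x. ln (p x)"] nn by simp
    have "AE x in distr coupling lborel T. 0 < p x"
      unfolding distributed_distr_eq_density[OF D] by (subst AE_density) auto
    then show "AE z in coupling. 0 < p (T z)"
      using distributed_measurable[OF D] by (subst (asm) AE_distr_iff) auto
  qed
  note X = ln_law[OF distributed_coupling(1) meas(1) nonneg(1) int(1)]
    and Y = ln_law[OF distributed_coupling(2) meas(2) nonneg(2) int(2)]
    and D = ln_law[OF distributed_coupling(3) meas(3) nonneg(3) int(3)]
    and UY = ln_law[OF distributed_coupling(4) meas(3) nonneg(3) int(3)]
    and XV = ln_law[OF distributed_coupling(5) meas(3) nonneg(3) int(3)]
    and S = ln_law[OF distributed_coupling(6) meas(4) nonneg(4) int(4)]
  \<comment> \<open>\<open>L\<close> is the split form of the log-likelihood ratio: it is integrable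
    term by term, and equals \<open>ln (likelihood_ratio z)\<close> wherever all six densities are
    positive.\<close>
  define L where "L z = ln (k (case z of (u, v, d, x, y) \<Rightarrow> d)) + ln (k (case z of (u, v, d, x, y) \<Rightarrow> u - y))
    + ln (k (case z of (u, v, d, x, y) \<Rightarrow> x - v)) - ln (f (case z of (u, v, d, x, y) \<Rightarrow> x))
    - ln (g (case z of (u, v, d, x, y) \<Rightarrow> y)) - ln (s (case z of (u, v, d, x, y) \<Rightarrow> u + v))" for z
  have ratio_nonneg: "0 \<le> likelihood_ratio z" for z
    using nonneg by (auto simp: likelihood_ratio_def split: prod.split)
  have ratio_int: "integrable coupling likelihood_ratio"
    using nn_integral_likelihood_ratio_le ratio_nonneg
    by (intro integrableI_nonneg) (auto intro: le_less_trans)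
  have "ennreal (\<integral>z. likelihood_ratio z \<partial>coupling) \<le> 1"
    using nn_integral_likelihood_ratio_le ratio_nonneg
    by (subst nn_integral_eq_integral[OF ratio_int, symmetric]) auto
  then have ratio_le: "(\<integral>z. likelihood_ratio z \<partial>coupling) \<le> 1"
    by (simp add: ennreal_le_1)
  have "AE z in coupling. L z \<le> likelihood_ratio z - 1"
    using X(3) Y(3) D(3) UY(3) XV(3) S(3)
  proof eventually_elim
    case (elim z)
    obtain u v d x y where z: "z = (u, v, d, x, y)" by (cases z)
    have pos: "0 < f x" "0 < g y" "0 < k d" "0 < k (u - y)" "0 < k (x - v)" "0 < s (u + v)"
      using elim by (simp_all add: z)
    have "L z = ln (likelihood_ratio z)"
      using pos by (simp add: L_def z likelihood_ratio_def ln_mult ln_div)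
    also have "\<dots> \<le> likelihood_ratio z - 1"
      using pos by (intro ln_le_minus_one) (simp add: z likelihood_ratio_def)
    finally show ?case .
  qed
  then have "(\<integral>z. L z \<partial>coupling) \<le> (\<integral>z. likelihood_ratio z - 1 \<partial>coupling)"
    unfolding L_def using X(1) Y(1) D(1) UY(1) XV(1) S(1) ratio_int
    by (intro integral_mono_AE) simp_all
  also have "\<dots> \<le> 0"
    using ratio_int ratio_le by (simp add: prob_space)
  finally show ?thesis
    unfolding L_def using X(1,2) Y(1,2) D(1,2) UY(1,2) XV(1,2) S(1,2) by simp
qed

end

section \<open>From independent random variables to the convolution identities\<close>

lemma distributed_uminus:
  fixes Y :: "'a \<Rightarrow> real"
  assumes Y: "distributed M lborel Y g"
  shows "distributed M lborel (\<lambda>\<omega>. - Y \<omega>) (\<lambda>y. g (- y))"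
proof (rule distributed_lborelI)
  have [measurable]: "g \<in> borel_measurable borel" "Y \<in> borel_measurable M"
    using distributed_borel_measurable[OF Y] distributed_measurable[OF Y] by simp_all
  show "(\<lambda>\<omega>. - Y \<omega>) \<in> borel_measurable M" "(\<lambda>y. g (- y)) \<in> borel_measurable borel"
    by measurable
  fix \<phi> :: "real \<Rightarrow> ennreal" assume [measurable]: "\<phi> \<in> borel_measurable borel"
  have "(\<integral>\<^sup>+\<omega>. \<phi> (- Y \<omega>) \<partial>M) = (\<integral>\<^sup>+y. g y * \<phi> (- y) \<partial>lborel)"
    by (rule distributed_nn_integral[OF Y, symmetric]) simp
  also have "\<dots> = (\<integral>\<^sup>+y. g (- y) * \<phi> y \<partial>lborel)"
    using nn_integral_lborel_reflect[of "\<lambda>y. g y * \<phi> (- y)" 0] by simp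
  finally show "(\<integral>\<^sup>+\<omega>. \<phi> (- Y \<omega>) \<partial>M) = (\<integral>\<^sup>+y. g (- y) * \<phi> y \<partial>lborel)" .
qed

text \<open>X - Y is the sum of the independent variables X and -Y; reflecting \<open>y\<close> in
  their convolution gives the form of \<open>conv_diff\<close>.\<close>

lemma (in prob_space) distributed_diff_indep:
  fixes X Y :: "'a \<Rightarrow> real"
  assumes indep: "indep_var borel X borel Y"
    and X: "distributed M lborel X f" and Y: "distributed M lborel Y g"
  shows "distributed M lborel (\<lambda>\<omega>. X \<omega> - Y \<omega>) (\<lambda>d. \<integral>\<^sup>+y. f (y + d) * g y \<partial>lborel)"
proof -
  have [measurable]: "f \<in> borel_measurable borel" "g \<in> borel_measurable borel"
    using distributed_borel_measurable[OF X] distributed_borel_measurable[OF Y] by simp_all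
  have "indep_var borel ((\<lambda>x. x) \<circ> X) borel (uminus \<circ> Y)"
    by (rule indep_var_compose[OF indep]) simp_all
  then have "indep_var borel X borel (\<lambda>\<omega>. - Y \<omega>)"
    by (simp add: comp_def)
  note distributed_convolution[OF this X distributed_uminus[OF Y]]
  moreover have "(\<integral>\<^sup>+y. f (d - y) * g (- y) \<partial>lborel) = (\<integral>\<^sup>+y. f (y + d) * g y \<partial>lborel)" for d
    using nn_integral_lborel_reflect[of "\<lambda>y. f (y + d) * g y" 0] by simp
  ultimately show ?thesis by simp
qed

theorem mainTheorem7:
  fixes M :: "'a measure" and X Y :: "'a \<Rightarrow> real"
  assumes "prob_space M"
    and "prob_space.indep_var M borel X borel Y"
    and "has_finite_diff_entropy M X"
    and "has_finite_diff_entropy M Y"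
    and "has_finite_diff_entropy M (\<lambda>\<omega>. X \<omega> + Y \<omega>)"
    and "has_finite_diff_entropy M (\<lambda>\<omega>. X \<omega> - Y \<omega>)"
  shows "diff_entropy M (\<lambda>\<omega>. X \<omega> + Y \<omega>)
           \<le> 3 * diff_entropy M (\<lambda>\<omega>. X \<omega> - Y \<omega>) - diff_entropy M X - diff_entropy M Y"
proof -
  interpret prob_space M by fact
  interpret information_space M "exp 1" by unfold_locales simp
  note indep = assms(2)
  obtain f g s k where fin: "finite_entropy lborel X f" "finite_entropy lborel Y g"
    "finite_entropy lborel (\<lambda>\<omega>. X \<omega> + Y \<omega>) s" "finite_entropy lborel (\<lambda>\<omega>. X \<omega> - Y \<omega>) k"
    using assms(3-6) unfolding has_finite_diff_entropy_def by blast
  note dist = fin[THEN finite_entropy_distributed]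
  have nn: "0 \<le> f x" "0 \<le> g x" "0 \<le> s x" "0 \<le> k x" for x
    using fin[THEN finite_entropy_nn] by simp_all
  have total: "(\<integral>\<^sup>+x. ennreal (p x) \<partial>lborel) = 1"
    if "distributed M lborel Z (\<lambda>x. ennreal (p x))" for Z p
    using distributed_nn_integral[OF that, of "\<lambda>_. 1"] by (simp add: emeasure_space_1)
  \<comment> \<open>Densities are unique almost everywhere, so the given \<open>k\<close> and
    \<open>s\<close> agree with the convolutions.\<close>
  interpret convolved_densities f g k s
  proof
    show "AE d in lborel. (\<integral>\<^sup>+y. ennreal (f (y + d)) * ennreal (g y) \<partial>lborel) = ennreal (k d)"
      by (rule distributed_unique[OF distributed_diff_indep[OF indep dist(1,2)] dist(4)])
    show "AE t in lborel. (\<integral>\<^sup>+y. ennreal (f (t - y)) * ennreal (g y) \<partial>lborel) = ennreal (s t)"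
      by (rule distributed_unique[OF distributed_convolution[OF indep dist(1,2)] dist(3)])
  qed (use fin[THEN finite_entropy_measurable] nn dist[THEN total] in simp_all)
  \<comment> \<open>The logarithm to base \<open>exp 1\<close> is \<open>ln\<close>, which matches
    the integrals in \<open>entropy_sum_le\<close>.\<close>
  have entropy: "diff_entropy M Z = - (\<integral>x. p x * ln (p x) \<partial>lborel)"
      "integrable lborel (\<lambda>x. p x * ln (p x))"
    if "finite_entropy lborel Z p" for Z p
    using entropy_distr[OF finite_entropy_distributed[OF that]] finite_entropy_nn[OF that]
      finite_entropy_integrable[OF that]
    by (simp_all add: diff_entropy_def log_def)
  show ?thesis
    using entropy_sum_le[OF fin(1,2,4,3)[THEN entropy(2)]] by (simp add: fin[THEN entropy(1)])
qed

end
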